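(* Let $r\ge 1$ and let $\tilde\alpha$ be the highest root of $\mathfrak{sl}_{r+1}=\mathfrak{sl}_{r+1}(\mathbb C)$. If $\sigma\in\mathcal A(\tilde\alpha,0)$, then $$\wp_q(\sigma(\tilde\alpha+\rho)-\rho)=q^{1+\ell(\sigma)}(1+q)^{r-1-2\ell(\sigma)} .$$
   Context: Setting: let $n=r+1$, $\mathfrak g=\mathfrak{sl}_n(\mathbb C)$, with Cartan subalgebra $\mathfrak h$ of diagonal trace-zero matrices and Borel subalgebra of upper triangular trace-zero matrices. For $1\le i\le n$ let $\varepsilon_i\in\mathfrak h^*$ send a diagonal matrix to its $i$-th entry (so $\varepsilon_1+\cdots+\varepsilon_n=0$ on $\mathfrak h$). The Weyl group is $W=S_n$, acting on $\mathfrak h^*$ by $\sigma(\varepsilon_i)=\varepsilon_{\sigma(i)}$. The positive roots are $\Phi^+=\{\varepsilon_i-\varepsilon_j: 1\le i<j\le n\}$, the highest root is $\tilde\alpha=\varepsilon_1-\varepsilon_n$, and $\rho=\frac12\sum_{\alpha\in\Phi^+}\alpha$. For $\sigma\in W$, $\ell(\sigma)$ is the length of $\sigma$ with respect to the neighboring transpositions $(i\;\;i+1)$. Kostant's partition function and its $q$-analog: for $\xi\in\mathfrak h^*$, $\wp(\xi)$ is the number of ways to write $\xi$ as a non-negative integral sum of positive roots (i.e. the number of functions $m:\Phi^+\to\{0,1,2,\dots\}$ with $\sum_{\beta}m(\beta)\beta=\xi$), and $\wp_q(\xi)=\sum_{j\ge 0}c_jq^j$, where $c_j$ is the number of such ways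 using exactly $j$ positive roots counted with multiplicity (i.e. with $\sum_\beta m(\beta)=j$). Weyl alternation set: for dominant integral weights $\lambda,\mu$, $\mathcal A(\lambda,\mu)=\{\sigma\in W:\wp(\sigma(\lambda+\rho)-(\mu+\rho))>0\}$. *)

theory Defs
  imports
    "Jordan_Normal_Form.Matrix"
    "HOL-Library.Function_Algebras"
    "HOL-Library.FuncSet"
    "HOL-Combinatorics.Permutations"
    "HOL-Computational_Algebra.Polynomial"
begin

text \<open>
  Matrix entries, the functionals \<open>eps n i\<close> and the letters permuted by the Weyl group are indexed
  by \<open>0, \<dots>, n - 1\<close>.
\<close>

definition sl :: "nat \<Rightarrow> complex mat set" where
  "sl n = {A \<in> carrier_mat n n. (\<Sum>i<n. A $$ (i, i)) = 0}"

definition cartan :: "nat \<Rightarrow> complex mat set" where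
  "cartan n = {H \<in> sl n. diagonal_mat H}"

text \<open>
  Elements of the dual space of \<open>cartan n\<close> are represented by functions that vanish outside
  \<open>cartan n\<close>, so that HOL equality is equality of functionals on \<open>cartan n\<close> (in particular the
  sum of all \<open>eps n i\<close> is \<open>0\<close>) and the pointwise operations on functions are the vector space
  operations.
\<close>

type_synonym weight = "complex mat \<Rightarrow> complex"

definition eps :: "nat \<Rightarrow> nat \<Rightarrow> weight" where
  "eps n i = (\<lambda>H. if H \<in> cartan n then H $$ (i, i) else 0)"

definition scale_weight :: "complex \<Rightarrow> weight \<Rightarrow> weight" where
  "scale_weight c \<xi> = (\<lambda>H. c * \<xi> H)"

definition positive_roots :: "nat \<Rightarrow> weight set" where
  "positive_roots n = {eps n i - eps n j | i j. i < j \<and> j < n}"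

definition highest_root :: "nat \<Rightarrow> weight" where
  "highest_root n = eps n 0 - eps n (n - 1)"

definition rho :: "nat \<Rightarrow> weight" where
  "rho n = scale_weight (1 / 2) (\<Sum>\<alpha>\<in>positive_roots n. \<alpha>)"

text \<open>
  The action dual to permuting diagonal entries; by the lemmas below it is the linear action with
  \<open>\<sigma> (eps n i) = eps n (\<sigma> i)\<close>.
\<close>

definition weyl_act :: "nat \<Rightarrow> (nat \<Rightarrow> nat) \<Rightarrow> weight \<Rightarrow> weight" where
  "weyl_act n \<sigma> \<xi> =
     (\<lambda>H. if H \<in> cartan n then \<xi> (mat_diag n (\<lambda>i. H $$ (\<sigma> i, \<sigma> i))) else 0)"

lemma weyl_act_eps:
  assumes "\<sigma> permutes {..<n}" "i < n"
  shows "weyl_act n \<sigma> (eps n i) = eps n (\<sigma> i)"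
proof -
  have "mat_diag n (\<lambda>i. H $$ (\<sigma> i, \<sigma> i)) \<in> cartan n" if "H \<in> cartan n" for H
    using that sum.permute[OF assms(1), of "\<lambda>i. H $$ (i, i)"]
    by (auto simp: cartan_def sl_def diagonal_mat_def mat_diag_def)
  then show ?thesis
    using assms(2) by (auto simp: weyl_act_def eps_def mat_diag_def fun_eq_iff)
qed

lemma weyl_act_add: "weyl_act n \<sigma> (\<xi> + \<eta>) = weyl_act n \<sigma> \<xi> + weyl_act n \<sigma> \<eta>"
  by (auto simp: weyl_act_def fun_eq_iff)

lemma weyl_act_scale: "weyl_act n \<sigma> (scale_weight c \<xi>) = scale_weight c (weyl_act n \<sigma> \<xi>)"
  by (auto simp: weyl_act_def scale_weight_def fun_eq_iff)

definition weyl_length :: "nat \<Rightarrow> (nat \<Rightarrow> nat) \<Rightarrow> nat" where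
  "weyl_length n \<sigma> =
     (LEAST k. \<exists>is. length is = k \<and> (\<forall>i\<in>set is. Suc i < n) \<and>
        \<sigma> = foldr (\<lambda>i \<tau>. Transposition.transpose i (Suc i) \<circ> \<tau>) is id)"

definition kostant_partitions :: "nat \<Rightarrow> weight \<Rightarrow> (weight \<Rightarrow> nat) set" where
  "kostant_partitions n \<xi> =
     {m \<in> positive_roots n \<rightarrow>\<^sub>E UNIV.
        (\<Sum>\<beta>\<in>positive_roots n. scale_weight (of_nat (m \<beta>)) \<beta>) = \<xi>}"

definition kostant :: "nat \<Rightarrow> weight \<Rightarrow> nat" where
  "kostant n \<xi> = card (kostant_partitions n \<xi>)"

definition kostant_coeff :: "nat \<Rightarrow> weight \<Rightarrow> nat \<Rightarrow> nat" where
  "kostant_coeff n \<xi> j = card {m \<in> kostant_partitions n \<xi>. (\<Sum>\<beta>\<in>positive_roots n. m \<beta>) = j}"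

text \<open>
  The sets counted here are finite and only finitely many coefficients are nonzero; see
  \<open>finite_kostant_partitions\<close> and \<open>coeff_kostant_q\<close> below.
\<close>

definition kostant_q :: "nat \<Rightarrow> weight \<Rightarrow> int poly" where
  "kostant_q n \<xi> =
     (\<Sum>j | kostant_coeff n \<xi> j \<noteq> 0. monom (int (kostant_coeff n \<xi> j)) j)"

definition weyl_alternation_set :: "nat \<Rightarrow> weight \<Rightarrow> weight \<Rightarrow> (nat \<Rightarrow> nat) set" where
  "weyl_alternation_set n lam mu =
     {\<sigma>. \<sigma> permutes {..<n} \<and> kostant n (weyl_act n \<sigma> (lam + rho n) - (mu + rho n)) > 0}"

lemma finite_positive_roots: "finite (positive_roots n)"
proof -
  have "positive_roots n \<subseteq> (\<lambda>(i, j). eps n i - eps n j) ` ({..<n} \<times> {..<n})"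
    by (auto simp: positive_roots_def)
  then show ?thesis
    by (rule finite_subset) auto
qed

text \<open>
  A coweight that is at least \<open>1\<close> on every positive root (twice the dual Weyl vector).
\<close>

lemma positive_functional:
  obtains H where "\<And>\<beta>. \<beta> \<in> positive_roots n \<Longrightarrow> Re (\<beta> H) \<ge> 1"
proof
  define f :: "nat \<Rightarrow> complex" where "f i = of_real (real n - 1 - 2 * real i)" for i
  have *: "(\<Sum>i<k. real m - 1 - 2 * real i) = real k * (real m - real k)" for k m :: nat
    by (induction k) (auto simp: algebra_simps)
  have "(\<Sum>i<n. f i) = of_real (\<Sum>i<n. real n - 1 - 2 * real i)"
    unfolding f_def by simp
  then have "(\<Sum>i<n. f i) = 0"
    by (simp only: *) simp
  then have mem: "mat_diag n f \<in> cartan n"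
    by (auto simp: cartan_def sl_def diagonal_mat_def mat_diag_def)
  show "Re (\<beta> (mat_diag n f)) \<ge> 1" if "\<beta> \<in> positive_roots n" for \<beta>
  proof -
    from that obtain i j where ij: "\<beta> = eps n i - eps n j" "i < j" "j < n"
      by (auto simp: positive_roots_def)
    then have "Re (\<beta> (mat_diag n f)) = 2 * (real j - real i)"
      using mem by (simp add: eps_def mat_diag_def f_def)
    then show ?thesis using ij by simp
  qed
qed

lemma kostant_partitions_bounded:
  obtains B :: nat where "\<And>m. m \<in> kostant_partitions n \<xi> \<Longrightarrow> (\<Sum>\<beta>\<in>positive_roots n. m \<beta>) \<le> B"
proof -
  obtain H where H: "\<And>\<beta>. \<beta> \<in> positive_roots n \<Longrightarrow> Re (\<beta> H) \<ge> 1"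
    using positive_functional by blast
  have app: "(\<Sum>\<beta>\<in>A. g \<beta>) H = (\<Sum>\<beta>\<in>A. g \<beta> H)" for A and g :: "weight \<Rightarrow> weight"
    by (induction A rule: infinite_finite_induct) auto
  have "(\<Sum>\<beta>\<in>positive_roots n. m \<beta>) \<le> nat \<lfloor>Re (\<xi> H)\<rfloor>" if "m \<in> kostant_partitions n \<xi>" for m
  proof -
    have "\<xi> H = (\<Sum>\<beta>\<in>positive_roots n. of_nat (m \<beta>) * \<beta> H)"
      using that by (auto simp: kostant_partitions_def app scale_weight_def)
    then have "Re (\<xi> H) = (\<Sum>\<beta>\<in>positive_roots n. real (m \<beta>) * Re (\<beta> H))"
      by simp
    also have "\<dots> \<ge> (\<Sum>\<beta>\<in>positive_roots n. real (m \<beta>) * 1)"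
      by (intro sum_mono mult_left_mono H) auto
    finally have "real (\<Sum>\<beta>\<in>positive_roots n. m \<beta>) \<le> Re (\<xi> H)"
      by simp
    then show ?thesis by linarith
  qed
  then show ?thesis using that by blast
qed

lemma finite_kostant_partitions: "finite (kostant_partitions n \<xi>)"
proof -
  obtain B :: nat where B: "\<And>m. m \<in> kostant_partitions n \<xi> \<Longrightarrow> (\<Sum>\<beta>\<in>positive_roots n. m \<beta>) \<le> B"
    using kostant_partitions_bounded by blast
  have "m \<beta> \<le> B" if "m \<in> kostant_partitions n \<xi>" "\<beta> \<in> positive_roots n" for m \<beta>
    using B[OF that(1)] member_le_sum[of \<beta> "positive_roots n" m] that(2) finite_positive_roots
    by fastforce
  then have "kostant_partitions n \<xi> \<subseteq> positive_roots n \<rightarrow>\<^sub>E {..B}"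
    by (fastforce simp: kostant_partitions_def PiE_iff extensional_def)
  then show ?thesis
    by (rule finite_subset) (simp add: finite_PiE finite_positive_roots)
qed

lemma finite_kostant_coeff_support: "finite {j. kostant_coeff n \<xi> j \<noteq> 0}"
proof -
  obtain B :: nat where B: "\<And>m. m \<in> kostant_partitions n \<xi> \<Longrightarrow> (\<Sum>\<beta>\<in>positive_roots n. m \<beta>) \<le> B"
    using kostant_partitions_bounded by blast
  have "{j. kostant_coeff n \<xi> j \<noteq> 0} \<subseteq> {..B}"
    using B by (auto simp: kostant_coeff_def card_eq_0_iff)
  then show ?thesis
    by (rule finite_subset) simp
qed

lemma coeff_kostant_q: "coeff (kostant_q n \<xi>) j = int (kostant_coeff n \<xi> j)"
  using finite_kostant_coeff_support[of n \<xi>]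
  by (simp add: kostant_q_def coeff_sum if_distrib sum.delta cong: if_cong)

end

theory Submission
  imports Defs
begin

text \<open>
  Write \<open>\<alpha>\<^sub>k = \<epsilon>\<^sub>k - \<epsilon>\<^sub>k\<^sub>+\<^sub>1\<close> for the simple roots, \<open>0 \<le> k < r\<close>, and put \<open>\<tau> = \<sigma>\<^sup>-\<^sup>1\<close>,
  \<open>\<xi> = \<sigma>(\<lambda> + \<rho>) - \<rho>\<close> with \<open>\<lambda>\<close> the highest root. There are two independent parts.

  Which \<open>\<sigma>\<close> occur. Up to a multiple of \<open>\<Sum>\<^sub>i \<epsilon>\<^sub>i = 0\<close>, the vector \<open>\<rho>\<close> has coordinates \<open>-i\<close>, so
  \<open>\<xi>\<close> has coordinates \<open>k - \<tau> k + [\<tau> k = 0] - [\<tau> k = r]\<close>, and its coefficients at the simple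
  roots are the partial sums of these coordinates. A weight with a partition into positive roots
  has coefficients that are at least \<open>0\<close>. The sum of \<open>\<tau> j - j\<close> over an initial segment is never
  negative, so almost no room is left: reading \<open>\<tau>\<close> from left to right, it must fix \<open>0\<close>, and from
  then on every step either fixes a letter or swaps two neighbouring letters, and \<open>r\<close> is fixed too
  (\<open>eq_adjacent_swaps_ascents\<close>). Thus \<open>\<sigma> = \<tau>\<close> is a product of commuting transpositions
  \<open>(a a+1)\<close>, \<open>a \<in> D\<close>, where \<open>D \<subseteq> {1, \<dots>, r - 2}\<close> has no two neighbouring elements, and
  \<open>\<xi> = \<Sum> {\<alpha>\<^sub>k | k \<notin> D}\<close>. A word in the neighbouring transpositions that does not use the letter \<open>a\<close>
  preserves \<open>{0, \<dots>, a}\<close>, so every word for \<open>\<sigma>\<close> uses each \<open>a \<in> D\<close>, and \<open>\<ell>(\<sigma>) = |D|\<close>.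

  The partition function at \<open>\<xi>\<close>. Positive roots are sums of the \<open>\<alpha>\<^sub>k\<close> over nonempty intervals, so a
  Kostant partition of \<open>\<Sum> {\<alpha>\<^sub>k | k \<in> K}\<close> is a partition of the set \<open>K\<close> into intervals. It is
  determined by the set \<open>S\<close> of left end points of its parts: any \<open>S\<close> with \<open>L \<subseteq> S \<subseteq> K\<close> arises, where
  \<open>L\<close> consists of the left end points of the maximal runs in \<open>K\<close>, and the number of parts is \<open>|S|\<close>.
  Summing \<open>q\<^bsup>|S|\<^esup>\<close> gives \<open>q\<^bsup>|L|\<^esup> (1 + q)\<^bsup>|K - L|\<^esup>\<close> (\<open>kostant_q_sum_simple_roots\<close>).
  For \<open>K = {0, \<dots>, r - 1} - D\<close> the runs start at \<open>0\<close> and just after each element of \<open>D\<close>, whence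
  \<open>|L| = 1 + \<ell>(\<sigma>)\<close> and \<open>|K - L| = r - 1 - 2 \<ell>(\<sigma>)\<close>.
\<close>

section \<open>Coordinates with respect to the simple roots\<close>

definition simple_comb :: "nat \<Rightarrow> (nat \<Rightarrow> complex) \<Rightarrow> weight" where
  "simple_comb n a = (\<Sum>k<n - 1. scale_weight (a k) (eps n k - eps n (Suc k)))"

text \<open>
  The coweights dual to the simple roots: the indicator of \<open>{0, \<dots>, k}\<close>, shifted by a multiple of
  the identity to make the trace vanish. They read off the coefficients of a combination of simple
  roots, which is how linear independence of the simple roots is obtained.
\<close>
definition fund_coweight :: "nat \<Rightarrow> nat \<Rightarrow> complex mat" where
  "fund_coweight n k = mat_diag n (\<lambda>i. of_bool (i \<le> k) - of_nat (Suc k) / of_nat n)"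

lemma sum_weight_apply: "(\<Sum>x\<in>A. g x) H = (\<Sum>x\<in>A. (g x :: weight) H)"
  by (induction A rule: infinite_finite_induct) auto

lemma simple_comb_apply:
  assumes "H \<in> cartan n"
  shows "simple_comb n a H = (\<Sum>k<n - 1. a k * (H $$ (k, k) - H $$ (Suc k, Suc k)))"
  using assms by (simp add: simple_comb_def sum_weight_apply scale_weight_def eps_def)

lemma simple_comb_outside: "H \<notin> cartan n \<Longrightarrow> simple_comb n a H = 0"
  by (simp add: simple_comb_def sum_weight_apply scale_weight_def eps_def)

lemma fund_coweight_in_cartan:
  assumes "Suc k < n"
  shows "fund_coweight n k \<in> cartan n"
proof -
  have "{i. i < n \<and> i \<le> k} = {..k}"
    using assms by auto
  then have "(\<Sum>i<n. of_bool (i \<le> k) - of_nat (Suc k) / of_nat n :: complex) = 0"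
    using assms by (simp add: sum_subtractf of_bool_def sum.If_cases Int_def)
  then show ?thesis
    by (auto simp: fund_coweight_def cartan_def sl_def diagonal_mat_def mat_diag_def)
qed

lemma simple_comb_fund_coweight:
  assumes "Suc k < n"
  shows "simple_comb n a (fund_coweight n k) = a k"
proof -
  have "simple_comb n a (fund_coweight n k) = (\<Sum>i<n - 1. if i = k then a k else 0)"
    unfolding simple_comb_apply[OF fund_coweight_in_cartan[OF assms]]
    by (rule sum.cong) (auto simp: fund_coweight_def mat_diag_def)
  then show ?thesis
    using assms by simp
qed

lemma simple_comb_eq_iff:
  "simple_comb n a = simple_comb n b \<longleftrightarrow> (\<forall>k. Suc k < n \<longrightarrow> a k = b k)"
proof
  assume "simple_comb n a = simple_comb n b"
  then show "\<forall>k. Suc k < n \<longrightarrow> a k = b k"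
    by (metis simple_comb_fund_coweight)
next
  assume "\<forall>k. Suc k < n \<longrightarrow> a k = b k"
  then show "simple_comb n a = simple_comb n b"
    unfolding simple_comb_def by (intro sum.cong) auto
qed

definition intervals :: "nat \<Rightarrow> (nat \<times> nat) set" where
  "intervals n = {(i, j). i < j \<and> j < n}"

text \<open>
  The pair \<open>(i, j)\<close> stands for the half-open interval \<open>{i..<j}\<close>, the support of
  \<open>\<epsilon>\<^sub>i - \<epsilon>\<^sub>j = \<alpha>\<^sub>i + \<dots> + \<alpha>\<^sub>j\<^sub>-\<^sub>1\<close>.
\<close>
definition interval_root :: "nat \<Rightarrow> nat \<times> nat \<Rightarrow> weight" where
  "interval_root n = (\<lambda>(i, j). eps n i - eps n j)"

lemma finite_intervals [simp]: "finite (intervals n)"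
  by (rule finite_subset[of _ "{..<n} \<times> {..<n}"]) (auto simp: intervals_def)

lemma interval_root_eq_simple_comb:
  assumes "(i, j) \<in> intervals n"
  shows "interval_root n (i, j) = simple_comb n (\<lambda>k. of_bool (i \<le> k \<and> k < j))"
proof
  fix H
  show "interval_root n (i, j) H = simple_comb n (\<lambda>k. of_bool (i \<le> k \<and> k < j)) H"
  proof (cases "H \<in> cartan n")
    case True
    have *: "{k. k < n - 1 \<and> i \<le> k \<and> k < j} = {i..<j}"
      using assms by (auto simp: intervals_def)
    have "simple_comb n (\<lambda>k. of_bool (i \<le> k \<and> k < j)) H =
        (\<Sum>k=i..<j. H $$ (k, k) - H $$ (Suc k, Suc k))"
      unfolding simple_comb_apply[OF True] * [symmetric]
      by (rule sum.mono_neutral_cong_right) auto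
    also have "\<dots> = H $$ (i, i) - H $$ (j, j)"
      using sum_Suc_diff'[of i j "\<lambda>k. - H $$ (k, k)"] assms by (simp add: intervals_def)
    finally show ?thesis
      using True by (simp add: interval_root_def eps_def)
  next
    case False
    then show ?thesis
      by (simp add: interval_root_def eps_def simple_comb_outside)
  qed
qed

lemma bij_betw_interval_root: "bij_betw (interval_root n) (intervals n) (positive_roots n)"
proof (rule bij_betw_imageI)
  show "inj_on (interval_root n) (intervals n)"
  proof (rule inj_onI, clarify)
    fix i j i' j'
    assume *: "(i, j) \<in> intervals n" "(i', j') \<in> intervals n" "interval_root n (i, j) = interval_root n (i', j')"
    then have "\<forall>k. Suc k < n \<longrightarrow> (i \<le> k \<and> k < j) = (i' \<le> k \<and> k < j')"
      by (simp add: interval_root_eq_simple_comb simple_comb_eq_iff of_bool_eq_iff)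
    moreover have "i < j" "j < n" "i' < j'" "j' < n"
      using *(1,2) by (auto simp: intervals_def)
    ultimately have "k \<in> {i..<j} \<longleftrightarrow> k \<in> {i'..<j'}" for k
      by (cases "Suc k < n") auto
    then have "{i..<j} = {i'..<j'}"
      by blast
    then show "i = i' \<and> j = j'"
      using atLeastLessThan_eq_iff[OF \<open>i < j\<close> \<open>i' < j'\<close>] by simp
  qed
  show "interval_root n ` intervals n = positive_roots n"
    by (auto simp: interval_root_def intervals_def positive_roots_def image_iff)
qed

lemma sum_positive_roots: "(\<Sum>\<beta>\<in>positive_roots n. g \<beta>) = (\<Sum>p\<in>intervals n. g (interval_root n p))"
  by (rule sum.reindex_bij_betw[OF bij_betw_interval_root, symmetric])

lemma simple_comb_sum:
  "(\<Sum>x\<in>A. scale_weight (c x) (simple_comb n (f x))) = simple_comb n (\<lambda>k. \<Sum>x\<in>A. c x * f x k)"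
proof
  fix H
  show "(\<Sum>x\<in>A. scale_weight (c x) (simple_comb n (f x))) H =
      simple_comb n (\<lambda>k. \<Sum>x\<in>A. c x * f x k) H"
  proof (cases "H \<in> cartan n")
    case True
    let ?d = "\<lambda>k. H $$ (k, k) - H $$ (Suc k, Suc k)"
    have "(\<Sum>x\<in>A. scale_weight (c x) (simple_comb n (f x))) H =
        (\<Sum>x\<in>A. \<Sum>k<n - 1. c x * f x k * ?d k)"
      using True
      by (simp add: sum_weight_apply scale_weight_def simple_comb_apply sum_distrib_left mult.assoc)
    also have "\<dots> = (\<Sum>k<n - 1. \<Sum>x\<in>A. c x * f x k * ?d k)"
      by (rule sum.swap)
    finally show ?thesis
      using True by (simp add: simple_comb_apply sum_distrib_right)
  next
    case False
    then show ?thesis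
      by (simp add: sum_weight_apply scale_weight_def simple_comb_outside)
  qed
qed

section \<open>Kostant partitions as coverings by intervals\<close>

definition cover :: "nat \<Rightarrow> (weight \<Rightarrow> nat) \<Rightarrow> nat \<Rightarrow> nat" where
  "cover n m k = (\<Sum>p | p \<in> intervals n \<and> fst p \<le> k \<and> k < snd p. m (interval_root n p))"

lemma sum_roots_eq_simple_comb:
  "(\<Sum>\<beta>\<in>positive_roots n. scale_weight (of_nat (m \<beta>)) \<beta>) = simple_comb n (\<lambda>k. of_nat (cover n m k))"
proof -
  have "(\<Sum>\<beta>\<in>positive_roots n. scale_weight (of_nat (m \<beta>)) \<beta>) =
      (\<Sum>p\<in>intervals n. scale_weight (of_nat (m (interval_root n p)))
        (simple_comb n (\<lambda>k. of_bool (fst p \<le> k \<and> k < snd p))))"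
    unfolding sum_positive_roots
    by (rule sum.cong) (auto simp flip: interval_root_eq_simple_comb)
  also have "\<dots> = simple_comb n (\<lambda>k. of_nat (cover n m k))"
    unfolding simple_comb_sum cover_def of_nat_sum
    by (intro arg_cong[where f = "simple_comb n"] ext sum.mono_neutral_cong_right) auto
  finally show ?thesis .
qed

text \<open>
  Comparing coefficients at the simple roots turns the equation between weights into a counting
  condition: the point \<open>k\<close> is covered as often as the coefficient at \<open>\<alpha>\<^sub>k\<close> says.
\<close>
lemma kostant_partitions_simple_comb:
  "m \<in> kostant_partitions n (simple_comb n a) \<longleftrightarrow>
     m \<in> positive_roots n \<rightarrow>\<^sub>E UNIV \<and> (\<forall>k. Suc k < n \<longrightarrow> of_nat (cover n m k) = a k)"
  by (simp add: kostant_partitions_def sum_roots_eq_simple_comb simple_comb_eq_iff)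

lemma kostant_q_eq_sum:
  "kostant_q n \<xi> = (\<Sum>m\<in>kostant_partitions n \<xi>. monom 1 (\<Sum>\<beta>\<in>positive_roots n. m \<beta>))"
proof (rule poly_eqI)
  fix j
  show "coeff (kostant_q n \<xi>) j =
      coeff (\<Sum>m\<in>kostant_partitions n \<xi>. monom 1 (\<Sum>\<beta>\<in>positive_roots n. m \<beta>)) j"
    unfolding coeff_kostant_q kostant_coeff_def coeff_sum coeff_monom
    by (simp add: sum.If_cases finite_kostant_partitions Int_def)
qed

section \<open>Interval partitions of a set of integers and their left end points\<close>

text \<open>The left end points of the maximal runs of consecutive elements of \<open>K\<close>.\<close>
definition left_ends :: "nat set \<Rightarrow> nat set" where
  "left_ends K = {k \<in> K. \<forall>l. k = Suc l \<longrightarrow> l \<notin> K}"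

text \<open>
  The parts of the interval partition of \<open>K\<close> with set of left end points \<open>S\<close>: a part begins at a
  point of \<open>S\<close> and goes on until the next point of \<open>S\<close> or the next gap of \<open>K\<close>.
\<close>
definition blocks :: "nat set \<Rightarrow> nat set \<Rightarrow> (nat \<times> nat) set" where
  "blocks K S = {(i, j). i < j \<and> i \<in> S \<and> {i<..<j} \<subseteq> K - S \<and> (j \<in> S \<or> j \<notin> K)}"

lemma blocks_unique:
  assumes "(i, j) \<in> blocks K S" "(i, j') \<in> blocks K S"
  shows "j = j'"
proof -
  have "\<not> j < j'" if "(i, j) \<in> blocks K S" "(i, j') \<in> blocks K S" for j j'
    using that by (fastforce simp: blocks_def)
  from this[OF assms] this[OF assms(2,1)] show ?thesis by simp
qed

lemma blocks_exists:
  assumes "K \<subseteq> {..<n}" "S \<subseteq> K" "i \<in> S"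
  obtains j where "(i, j) \<in> blocks K S" "j \<le> n"
proof -
  let ?P = "\<lambda>j. i < j \<and> (j \<in> S \<or> j \<notin> K)"
  have n: "?P n"
    using assms by auto
  define j where "j = (LEAST j. ?P j)"
  have j: "?P j" "j \<le> n"
    using LeastI[of ?P, OF n] Least_le[of ?P, OF n] by (auto simp: j_def)
  have "k \<in> K - S" if "i < k" "k < j" for k
    using not_less_Least[of k ?P] that by (auto simp: j_def)
  then have "(i, j) \<in> blocks K S"
    using assms(3) j(1) by (auto simp: blocks_def)
  with j(2) that show ?thesis by blast
qed

text \<open>
  Going down from \<open>k\<close> through \<open>K\<close>, one stays in \<open>K\<close> until a left end of a run is reached, and left
  ends of runs belong to \<open>S\<close>; so the part that contains \<open>k\<close> has a beginning.
\<close>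
lemma blocks_start_below:
  assumes "left_ends K \<subseteq> S" "k \<in> K"
  shows "\<exists>i\<in>S. i \<le> k \<and> {i<..k} \<subseteq> K - S"
  using assms(2)
proof (induction k)
  case 0
  then have "0 \<in> left_ends K" by (simp add: left_ends_def)
  with assms(1) show ?case by auto
next
  case (Suc k)
  show ?case
  proof (cases "Suc k \<in> S")
    case True
    then show ?thesis by auto
  next
    case False
    then have "k \<in> K"
      using assms(1) Suc.prems by (auto simp: left_ends_def)
    then obtain i where "i \<in> S" "i \<le> k" "{i<..k} \<subseteq> K - S"
      using Suc.IH by blast
    moreover have "{i<..Suc k} = insert (Suc k) {i<..k}"
      using \<open>i \<le> k\<close> by auto
    ultimately show ?thesis
      using False Suc.prems by (intro bexI[of _ i]) auto
  qed
qed

lemma card_blocks_covering: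
  assumes K: "K \<subseteq> {..<n}" and S: "left_ends K \<subseteq> S" "S \<subseteq> K"
  shows "card {p \<in> blocks K S. fst p \<le> k \<and> k < snd p} = of_bool (k \<in> K)"
proof (cases "k \<in> K")
  case True
  obtain i where i: "i \<in> S" "i \<le> k" "{i<..k} \<subseteq> K - S"
    using blocks_start_below[OF S(1) True] by blast
  obtain j where j: "(i, j) \<in> blocks K S"
    using blocks_exists[OF K S(2) i(1)] .
  have "k < j"
  proof (rule ccontr)
    assume "\<not> k < j"
    then have "j \<in> {i<..k}" using j by (auto simp: blocks_def)
    with i(3) j show False by (auto simp: blocks_def)
  qed
  have "p = (i, j)" if p: "p \<in> blocks K S" "fst p \<le> k" "k < snd p" for p
  proof -
    obtain i' j' where p': "p = (i', j')" by fastforce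
    have "\<not> i < i'"
      using p p' i by (auto simp: blocks_def)
    moreover have "\<not> i' < i"
    proof
      assume "i' < i"
      then have "i \<in> {i'<..<j'}"
        using p p' i by auto
      with p p' i(1) show False by (auto simp: blocks_def)
    qed
    ultimately have "i' = i" by simp
    then show ?thesis
      using blocks_unique j p(1) p' by blast
  qed
  moreover have "(i, j) \<in> {p \<in> blocks K S. fst p \<le> k \<and> k < snd p}"
    using i j \<open>k < j\<close> by simp
  ultimately have "{p \<in> blocks K S. fst p \<le> k \<and> k < snd p} = {(i, j)}"
    by blast
  then show ?thesis using True by simp
next
  case False
  have "k \<in> K" if p: "p \<in> blocks K S" "fst p \<le> k" "k < snd p" for p
  proof (cases "fst p = k")
    case True
    with p S(2) show ?thesis by (auto simp: blocks_def)
  next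
    case False
    with p(2,3) have "k \<in> {fst p<..<snd p}" by simp
    with p(1) show ?thesis by (auto simp: blocks_def)
  qed
  with False have none: "{p \<in> blocks K S. fst p \<le> k \<and> k < snd p} = {}"
    by blast
  show ?thesis unfolding none using False by simp
qed

lemma blocks_subset_intervals:
  assumes "K \<subseteq> {..<n - 1}" "S \<subseteq> K"
  shows "blocks K S \<subseteq> intervals n"
proof
  fix p assume p: "p \<in> blocks K S"
  obtain i j where ij: "p = (i, j)" by fastforce
  obtain j' where "(i, j') \<in> blocks K S" "j' \<le> n - 1"
    using blocks_exists[OF assms, of i] p ij by (auto simp: blocks_def)
  moreover from this have "j = j'" using p ij blocks_unique by blast
  moreover have "i < n - 1" using p ij assms by (auto simp: blocks_def)
  ultimately show "p \<in> intervals n"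
    using p ij by (auto simp: intervals_def blocks_def)
qed

lemma card_blocks:
  assumes "K \<subseteq> {..<n}" "S \<subseteq> K"
  shows "card (blocks K S) = card S"
proof -
  have "bij_betw fst (blocks K S) S"
  proof (rule bij_betw_imageI)
    show "inj_on fst (blocks K S)"
    proof (rule inj_onI)
      fix p p' assume *: "p \<in> blocks K S" "p' \<in> blocks K S" "fst p = fst p'"
      obtain i j j' where "p = (i, j)" "p' = (i, j')"
        using *(3) by (metis prod.collapse)
      with *(1,2) show "p = p'"
        using blocks_unique by simp
    qed
    show "fst ` blocks K S = S"
    proof
      show "fst ` blocks K S \<subseteq> S" by (auto simp: blocks_def)
      show "S \<subseteq> fst ` blocks K S"
      proof
        fix i assume "i \<in> S"
        then obtain j where "(i, j) \<in> blocks K S"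
          using blocks_exists[OF assms] by blast
        then show "i \<in> fst ` blocks K S" by force
      qed
    qed
  qed
  then show ?thesis by (rule bij_betw_same_card)
qed

section \<open>Kostant partitions of a sum of distinct simple roots\<close>

text \<open>
  The members of \<open>kostant_partitions\<close> take a default value off the positive roots; the restriction
  gives this function the same default, so that it can be equal to a member.
\<close>
definition partition_of_starts :: "nat \<Rightarrow> nat set \<Rightarrow> nat set \<Rightarrow> weight \<Rightarrow> nat" where
  "partition_of_starts n K S = (\<lambda>\<beta>\<in>positive_roots n. of_bool (\<beta> \<in> interval_root n ` blocks K S))"

definition starts :: "nat \<Rightarrow> (weight \<Rightarrow> nat) \<Rightarrow> nat set" where
  "starts n m = {i. \<exists>j. (i, j) \<in> intervals n \<and> m (interval_root n (i, j)) > 0}"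

lemma partition_of_starts_interval_root:
  assumes "K \<subseteq> {..<n - 1}" "S \<subseteq> K" "p \<in> intervals n"
  shows "partition_of_starts n K S (interval_root n p) = of_bool (p \<in> blocks K S)"
proof -
  have "interval_root n p \<in> positive_roots n"
    using bij_betw_interval_root assms(3) by (rule bij_betw_apply)
  moreover have "interval_root n p \<in> interval_root n ` blocks K S \<longleftrightarrow> p \<in> blocks K S"
    using bij_betw_imp_inj_on[OF bij_betw_interval_root] assms(3)
      blocks_subset_intervals[OF assms(1,2)]
    by (rule inj_on_image_mem_iff)
  ultimately show ?thesis
    by (simp add: partition_of_starts_def)
qed

lemma partition_of_starts_in_kostant_partitions:
  assumes "K \<subseteq> {..<n - 1}" "left_ends K \<subseteq> S" "S \<subseteq> K"
  shows "partition_of_starts n K S \<in> kostant_partitions n (simple_comb n (\<lambda>k. of_bool (k \<in> K)))"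
proof -
  have "cover n (partition_of_starts n K S) k = of_bool (k \<in> K)" for k
  proof -
    have eq: "{p \<in> blocks K S. fst p \<le> k \<and> k < snd p} =
        {p. p \<in> intervals n \<and> fst p \<le> k \<and> k < snd p} \<inter> blocks K S"
      using blocks_subset_intervals[OF assms(1,3)] by auto
    have "cover n (partition_of_starts n K S) k =
        (\<Sum>p | p \<in> intervals n \<and> fst p \<le> k \<and> k < snd p. of_bool (p \<in> blocks K S))"
      unfolding cover_def
      by (rule sum.cong) (auto simp: partition_of_starts_interval_root[OF assms(1,3)])
    also have "\<dots> = card {p \<in> blocks K S. fst p \<le> k \<and> k < snd p}"
      unfolding eq by (simp add: of_bool_def sum.If_cases)
    finally show ?thesis
      using card_blocks_covering[OF assms] by simp
  qed
  then show ?thesis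
    by (simp add: kostant_partitions_simple_comb) (simp add: partition_of_starts_def)
qed

lemma sum_partition_of_starts:
  assumes "K \<subseteq> {..<n - 1}" "S \<subseteq> K"
  shows "(\<Sum>\<beta>\<in>positive_roots n. partition_of_starts n K S \<beta>) = card S"
proof -
  have "(\<Sum>\<beta>\<in>positive_roots n. partition_of_starts n K S \<beta>) =
      (\<Sum>p\<in>intervals n. of_bool (p \<in> blocks K S))"
    unfolding sum_positive_roots
    by (rule sum.cong) (auto simp: partition_of_starts_interval_root[OF assms])
  also have "\<dots> = card (intervals n \<inter> blocks K S)"
    by (simp add: of_bool_def sum.If_cases)
  also have "intervals n \<inter> blocks K S = blocks K S"
    using blocks_subset_intervals[OF assms] by auto
  finally show ?thesis
    using card_blocks[OF assms] by simp
qed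

lemma starts_partition_of_starts:
  assumes "K \<subseteq> {..<n - 1}" "S \<subseteq> K"
  shows "starts n (partition_of_starts n K S) = S"
proof -
  have "starts n (partition_of_starts n K S) = fst ` (intervals n \<inter> blocks K S)"
    by (force simp: starts_def partition_of_starts_interval_root[OF assms] image_iff)
  also have "intervals n \<inter> blocks K S = blocks K S"
    using blocks_subset_intervals[OF assms] by auto
  also have "fst ` blocks K S = S"
    using blocks_exists[OF assms] by (force simp: blocks_def image_iff)
  finally show ?thesis .
qed

text \<open>
  Conversely, a Kostant partition of \<open>\<Sum> {\<alpha>\<^sub>k | k \<in> K}\<close> covers each point at most once. So its roots
  have multiplicity one and disjoint supports, and after the support of one of them either \<open>K\<close> has a
  gap or the next support begins. This makes it the partition given by its left end points.
\<close>

context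
  fixes n :: nat and K :: "nat set" and m :: "weight \<Rightarrow> nat"
  assumes K: "K \<subseteq> {..<n - 1}"
    and m: "m \<in> kostant_partitions n (simple_comb n (\<lambda>k. of_bool (k \<in> K)))"
begin

private lemma cover_m:
  assumes "Suc k < n"
  shows "cover n m k = of_bool (k \<in> K)"
proof -
  have "of_nat (cover n m k) = (of_nat (of_bool (k \<in> K)) :: complex)"
    using m assms by (simp add: kostant_partitions_simple_comb)
  then show ?thesis by (simp only: of_nat_eq_iff)
qed

private lemma covered_in_K:
  assumes "(i, j) \<in> intervals n" "m (interval_root n (i, j)) > 0" "i \<le> k" "k < j"
  shows "k \<in> K" "m (interval_root n (i, j)) = 1"
proof -
  have "m (interval_root n (i, j)) \<le> cover n m k"
    unfolding cover_def using assms
    by (intro member_le_sum[where f = "\<lambda>p. m (interval_root n p)"]) auto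
  moreover have "Suc k < n" using assms by (auto simp: intervals_def)
  ultimately show "k \<in> K" "m (interval_root n (i, j)) = 1"
    using cover_m[of k] assms(2) by (auto simp: of_bool_def split: if_splits)
qed

private lemma covering_unique:
  assumes "(i, j) \<in> intervals n" "m (interval_root n (i, j)) > 0" "i \<le> k" "k < j"
    and "(i', j') \<in> intervals n" "m (interval_root n (i', j')) > 0" "i' \<le> k" "k < j'"
  shows "i = i' \<and> j = j'"
proof (rule ccontr)
  assume ne: "\<not> (i = i' \<and> j = j')"
  have "m (interval_root n (i, j)) + m (interval_root n (i', j')) = (\<Sum>p\<in>{(i, j), (i', j')}. m (interval_root n p))"
    using ne by auto
  also have "\<dots> \<le> cover n m k"
    unfolding cover_def using assms by (intro sum_mono2) auto
  also have "\<dots> \<le> 1"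
    using assms by (subst cover_m) (auto simp: intervals_def)
  finally show False using assms by simp
qed

private lemma covered:
  assumes "k \<in> K"
  obtains i j where "(i, j) \<in> intervals n" "m (interval_root n (i, j)) > 0" "i \<le> k" "k < j"
proof -
  have "cover n m k \<noteq> 0"
    using assms K by (subst cover_m) auto
  then obtain p where "p \<in> intervals n" "fst p \<le> k" "k < snd p" "m (interval_root n p) \<noteq> 0"
    unfolding cover_def by (auto elim!: sum.not_neutral_contains_not_neutral)
  then show ?thesis
    using that[of "fst p" "snd p"] by auto
qed

lemma starts_subset: "starts n m \<subseteq> K"
  using covered_in_K by (fastforce simp: starts_def intervals_def)

lemma left_ends_subset_starts: "left_ends K \<subseteq> starts n m"
proof
  fix k assume k: "k \<in> left_ends K"
  then obtain i j where ij: "(i, j) \<in> intervals n" "m (interval_root n (i, j)) > 0" "i \<le> k" "k < j"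
    using covered[of k] by (auto simp: left_ends_def)
  have "i = k"
  proof (rule ccontr)
    assume "i \<noteq> k"
    then obtain l where "k = Suc l" "i \<le> l"
      using ij(3) by (cases k) auto
    with covered_in_K(1)[OF ij(1,2), of l] ij(4) k show False
      by (auto simp: left_ends_def)
  qed
  with ij show "k \<in> starts n m" by (auto simp: starts_def)
qed

private lemma in_blocks_starts:
  assumes ij: "(i, j) \<in> intervals n" "m (interval_root n (i, j)) > 0"
  shows "(i, j) \<in> blocks K (starts n m)"
proof -
  have "k \<in> K - starts n m" if "i < k" "k < j" for k
    using covered_in_K(1)[OF ij, of k] covering_unique[OF ij, of k k] that
    by (fastforce simp: starts_def intervals_def)
  moreover have "j \<in> starts n m" if "j \<in> K"
  proof -
    obtain i' j' where ij': "(i', j') \<in> intervals n" "m (interval_root n (i', j')) > 0" "i' \<le> j" "j < j'"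
      using covered[OF \<open>j \<in> K\<close>] by blast
    \<comment> \<open>Otherwise both intervals would cover \<open>j - 1\<close>.\<close>
    have "i' = j"
    proof (rule ccontr)
      assume "i' \<noteq> j"
      then have "i \<le> j - 1" "j - 1 < j" "i' \<le> j - 1" "j - 1 < j'"
        using ij(1) ij'(3,4) by (auto simp: intervals_def)
      then have "j = j'"
        using covering_unique[OF ij _ _ ij'(1,2)] by blast
      with ij'(4) show False by simp
    qed
    with ij' show ?thesis by (auto simp: starts_def)
  qed
  ultimately show ?thesis
    using ij by (auto simp: blocks_def starts_def intervals_def)
qed

lemma partition_of_starts_starts: "partition_of_starts n K (starts n m) = m"
proof
  fix \<beta>
  show "partition_of_starts n K (starts n m) \<beta> = m \<beta>"
  proof (cases "\<beta> \<in> positive_roots n")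
    case True
    then obtain i j where ij: "(i, j) \<in> intervals n" "\<beta> = interval_root n (i, j)"
      using bij_betw_interval_root[of n] by (force simp: bij_betw_def)
    have "m (interval_root n (i, j)) = of_bool ((i, j) \<in> blocks K (starts n m))"
    proof (cases "m (interval_root n (i, j)) > 0")
      case True
      then have "(i, j) \<in> blocks K (starts n m)" "m (interval_root n (i, j)) = 1"
        using in_blocks_starts[OF ij(1)] covered_in_K(2)[OF ij(1), of i] ij(1)
        by (auto simp: intervals_def)
      then show ?thesis by simp
    next
      case False
      have "(i, j) \<notin> blocks K (starts n m)"
      proof
        assume b: "(i, j) \<in> blocks K (starts n m)"
        then obtain j' where j': "(i, j') \<in> intervals n" "m (interval_root n (i, j')) > 0"
          by (auto simp: blocks_def starts_def)
        then have "j' = j"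
          using in_blocks_starts[OF j'] b blocks_unique by blast
        with j' False show False by simp
      qed
      with False show ?thesis by simp
    qed
    then show ?thesis
      using partition_of_starts_interval_root[OF K starts_subset ij(1)] ij(2) by simp
  next
    case False
    then show ?thesis
      using m by (auto simp: partition_of_starts_def kostant_partitions_def)
  qed
qed

end

lemma sum_Pow_monom_card:
  assumes "finite A"
  shows "(\<Sum>T\<in>Pow A. monom 1 (card T) :: int poly) = (1 + monom 1 1) ^ card A"
  using assms
proof (induction A)
  case (insert x A)
  have inj: "inj_on (insert x) (Pow A)"
    using insert.hyps by (auto simp: inj_on_def)
  have "(\<Sum>T\<in>Pow (insert x A). monom 1 (card T) :: int poly) =
      (\<Sum>T\<in>Pow A. monom 1 (card T)) + (\<Sum>T\<in>insert x ` Pow A. monom 1 (card T))"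
    unfolding Pow_insert using insert.hyps by (intro sum.union_disjoint) auto
  also have "(\<Sum>T\<in>insert x ` Pow A. monom 1 (card T) :: int poly) =
      (\<Sum>T\<in>Pow A. monom 1 (Suc (card T)))"
    unfolding sum.reindex[OF inj] o_def
    using insert.hyps by (intro sum.cong refl) (metis PowD card_insert_disjoint finite_subset subsetD)
  also have "\<dots> = monom 1 1 * (\<Sum>T\<in>Pow A. monom 1 (card T))"
    by (simp add: sum_distrib_left mult_monom)
  finally show ?case
    using insert by (simp add: algebra_simps)
qed simp

lemma kostant_q_sum_simple_roots:
  assumes K: "K \<subseteq> {..<n - 1}"
  shows "kostant_q n (simple_comb n (\<lambda>k. of_bool (k \<in> K))) =
    monom 1 1 ^ card (left_ends K) * (1 + monom 1 1) ^ card (K - left_ends K)"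
proof -
  let ?M = "left_ends K"
  let ?KP = "kostant_partitions n (simple_comb n (\<lambda>k. of_bool (k \<in> K)))"
  have MK: "?M \<subseteq> K" by (auto simp: left_ends_def)
  have fin: "finite K" using K finite_subset by blast
  have "kostant_q n (simple_comb n (\<lambda>k. of_bool (k \<in> K))) =
      (\<Sum>T\<in>Pow (K - ?M). monom 1 (card (?M \<union> T)))"
    unfolding kostant_q_eq_sum
  proof (rule sum.reindex_bij_witness[of _ "\<lambda>T. partition_of_starts n K (?M \<union> T)"
        "\<lambda>m. starts n m - ?M"])
    fix m assume m: "m \<in> ?KP"
    note st = starts_subset[OF K m] left_ends_subset_starts[OF K m]
    have un: "?M \<union> (starts n m - ?M) = starts n m"
      using st by auto
    show "partition_of_starts n K (?M \<union> (starts n m - ?M)) = m"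
      unfolding un by (rule partition_of_starts_starts[OF K m])
    show "starts n m - ?M \<in> Pow (K - ?M)"
      using st by auto
    show "monom (1::int) (card (?M \<union> (starts n m - ?M))) = monom 1 (\<Sum>\<beta>\<in>positive_roots n. m \<beta>)"
      unfolding un
      using sum_partition_of_starts[OF K st(1)] partition_of_starts_starts[OF K m] by simp
  next
    fix T assume T: "T \<in> Pow (K - ?M)"
    then have sub: "?M \<union> T \<subseteq> K" using MK by auto
    show "starts n (partition_of_starts n K (?M \<union> T)) - ?M = T"
      unfolding starts_partition_of_starts[OF K sub] using T by auto
    show "partition_of_starts n K (?M \<union> T) \<in> ?KP"
      by (rule partition_of_starts_in_kostant_partitions[OF K _ sub]) auto
  qed
  also have "\<dots> = (\<Sum>T\<in>Pow (K - ?M). monom 1 (card ?M) * monom 1 (card T))"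
  proof (rule sum.cong)
    fix T assume "T \<in> Pow (K - ?M)"
    then have "card (?M \<union> T) = card ?M + card T"
      using fin MK by (intro card_Un_disjoint) (auto intro: finite_subset)
    then show "monom (1::int) (card (?M \<union> T)) = monom 1 (card ?M) * monom 1 (card T)"
      by (simp add: mult_monom)
  qed simp
  also have "\<dots> = monom 1 (card ?M) * (1 + monom 1 1) ^ card (K - ?M)"
    using fin by (simp add: sum_Pow_monom_card flip: sum_distrib_left)
  finally show ?thesis
    by (simp add: monom_power)
qed


section \<open>The weight as a combination of simple roots\<close>

text \<open>
  The sum of the first \<open>k\<close> coordinates of \<open>\<sigma>(\<lambda> + \<rho>) - \<rho>\<close>, where \<open>\<lambda>\<close> is the highest root and
  \<open>\<tau> = \<sigma>\<^sup>-\<^sup>1\<close>. The first \<open>k\<close> coordinates of a simple root add up to \<open>1\<close> for \<open>\<alpha>\<^sub>k\<^sub>-\<^sub>1\<close> and to \<open>0\<close> for all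
  others, so for \<open>1 \<le> k < n\<close> this is the coefficient at \<open>\<alpha>\<^sub>k\<^sub>-\<^sub>1\<close>.
\<close>
definition simple_root_coeff :: "nat \<Rightarrow> (nat \<Rightarrow> nat) \<Rightarrow> nat \<Rightarrow> int" where
  "simple_root_coeff n \<tau> k =
     (\<Sum>j<k. int j - int (\<tau> j) + of_bool (\<tau> j = 0) - of_bool (\<tau> j = n - 1))"

lemma simple_root_coeff_Suc:
  "simple_root_coeff n \<tau> (Suc k) = simple_root_coeff n \<tau> k +
     (int k - int (\<tau> k) + of_bool (\<tau> k = 0) - of_bool (\<tau> k = n - 1))"
  by (simp add: simple_root_coeff_def)

text \<open>
  The sum of the positive roots has coordinates \<open>n - 1 - 2 i\<close>; the part \<open>n - 1\<close> that does not depend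
  on \<open>i\<close> is killed by the trace condition.
\<close>
lemma rho_apply:
  assumes "H \<in> cartan n"
  shows "rho n H = - (\<Sum>i<n. of_nat i * H $$ (i, i))"
proof -
  define h where "h i = H $$ (i, i)" for i
  have tr: "(\<Sum>i<n. h i) = 0"
    using assms by (simp add: h_def cartan_def sl_def)
  have split: "intervals (Suc m) = intervals m \<union> (\<lambda>i. (i, m)) ` {..<m}" for m
    by (auto simp: intervals_def less_Suc_eq)
  have *: "(\<Sum>(i, j)\<in>intervals m. h i - h j) = (\<Sum>i<m. (of_nat m - 1 - 2 * of_nat i) * h i)" for m
  proof (induction m)
    case (Suc m)
    have "(\<Sum>(i, j)\<in>intervals (Suc m). h i - h j) =
        (\<Sum>(i, j)\<in>intervals m. h i - h j) + (\<Sum>(i, j)\<in>(\<lambda>i. (i, m)) ` {..<m}. h i - h j)"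
      unfolding split by (rule sum.union_disjoint) (simp, simp, auto simp: intervals_def)
    also have "(\<Sum>(i, j)\<in>(\<lambda>i. (i, m)) ` {..<m}. h i - h j) = (\<Sum>i<m. h i) - of_nat m * h m"
      by (subst sum.reindex) (auto simp: inj_on_def sum_subtractf)
    finally show ?case
      unfolding Suc.IH by (simp add: algebra_simps sum.distrib sum_subtractf)
  qed (simp add: intervals_def)
  have "(\<Sum>\<alpha>\<in>positive_roots n. \<alpha>) H = (\<Sum>(i, j)\<in>intervals n. h i - h j)"
    unfolding sum_positive_roots sum_weight_apply
    by (rule sum.cong) (auto simp: interval_root_def eps_def h_def assms)
  also have "\<dots> = (of_nat n - 1) * (\<Sum>i<n. h i) - 2 * (\<Sum>i<n. of_nat i * h i)"
    unfolding * sum_distrib_left sum_subtractf[symmetric]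
    by (rule sum.cong) (simp_all add: algebra_simps)
  finally show ?thesis
    unfolding tr by (simp add: rho_def scale_weight_def h_def)
qed

lemma rho_outside: "H \<notin> cartan n \<Longrightarrow> rho n H = 0"
  by (auto simp: rho_def scale_weight_def sum_weight_apply positive_roots_def eps_def
      intro!: sum.neutral)

lemma sum_by_parts:
  fixes x h :: "nat \<Rightarrow> complex"
  shows "(\<Sum>k<Suc r. x k * h k) =
    (\<Sum>k<r. (\<Sum>j<Suc k. x j) * (h k - h (Suc k))) + (\<Sum>j<Suc r. x j) * h r"
  by (induction r) (simp_all add: algebra_simps)

lemma permuted_diag_in_cartan:
  assumes "\<sigma> permutes {..<n}" "H \<in> cartan n"
  shows "mat_diag n (\<lambda>i. H $$ (\<sigma> i, \<sigma> i)) \<in> cartan n"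
  using assms(2) sum.permute[OF assms(1), of "\<lambda>i. H $$ (i, i)"]
  by (auto simp: cartan_def sl_def diagonal_mat_def mat_diag_def)

lemma shifted_highest_root_eq_simple_comb:
  assumes \<sigma>: "\<sigma> permutes {..<n}" and n: "n \<ge> 2"
  shows "weyl_act n \<sigma> (highest_root n + rho n) - rho n =
    simple_comb n (\<lambda>k. of_int (simple_root_coeff n (inv_into UNIV \<sigma>) (Suc k)))"
proof
  fix H
  let ?\<tau> = "inv_into UNIV \<sigma>"
  show "(weyl_act n \<sigma> (highest_root n + rho n) - rho n) H =
      simple_comb n (\<lambda>k. of_int (simple_root_coeff n ?\<tau> (Suc k))) H"
  proof (cases "H \<in> cartan n")
    case False
    then show ?thesis
      by (simp add: weyl_act_def rho_outside simple_comb_outside)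
  next
    case H: True
    define h where "h k = H $$ (k, k)" for k
    \<comment> \<open>\<open>c\<close> and \<open>x\<close> are the coordinates of \<open>\<lambda> + \<rho>\<close> and of \<open>\<sigma>(\<lambda> + \<rho>) - \<rho>\<close>; summation by parts
      passes from coordinates to coefficients at the simple roots.\<close>
    define c :: "nat \<Rightarrow> complex" where
      "c i = of_bool (i = 0) - of_bool (i = n - 1) - of_nat i" for i
    define x :: "nat \<Rightarrow> complex" where "x k = c (?\<tau> k) + of_nat k" for k
    have \<tau>: "?\<tau> permutes {..<n}"
      using \<sigma> by (rule permutes_inv)
    have top: "(highest_root n + rho n) H' = (\<Sum>i<n. c i * H' $$ (i, i))" if "H' \<in> cartan n" for H'
    proof -
      have "(\<Sum>i<n. c i * H' $$ (i, i)) =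
          (\<Sum>i<n. if i = 0 then H' $$ (i, i) else 0) - (\<Sum>i<n. if i = n - 1 then H' $$ (i, i) else 0)
          - (\<Sum>i<n. of_nat i * H' $$ (i, i))"
        unfolding sum_subtractf[symmetric] by (rule sum.cong) (auto simp: c_def algebra_simps)
      then show ?thesis
        using that n by (simp add: highest_root_def eps_def rho_apply)
    qed
    have "weyl_act n \<sigma> (highest_root n + rho n) H =
        (\<Sum>i<n. c i * mat_diag n (\<lambda>i. H $$ (\<sigma> i, \<sigma> i)) $$ (i, i))"
      using top[OF permuted_diag_in_cartan[OF \<sigma> H]] H by (simp add: weyl_act_def)
    also have "\<dots> = (\<Sum>i<n. c i * h (\<sigma> i))"
      by (rule sum.cong) (simp_all add: mat_diag_def h_def)
    also have "\<dots> = (\<Sum>k<n. c (?\<tau> k) * h k)"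
      by (subst sum.permute[OF \<tau>]) (simp add: o_def permutes_inverses[OF \<sigma>])
    finally have "(weyl_act n \<sigma> (highest_root n + rho n) - rho n) H = (\<Sum>k<n. x k * h k)"
      using H by (simp add: rho_apply x_def h_def algebra_simps sum.distrib)
    also have "\<dots> = (\<Sum>k<n - 1. (\<Sum>j<Suc k. x j) * (h k - h (Suc k))) + (\<Sum>j<n. x j) * h (n - 1)"
      using sum_by_parts[of x h "n - 1"] n by simp
    also have "(\<Sum>j<n. x j) = 0"
    proof -
      have "(\<Sum>j<n. c (?\<tau> j)) = (\<Sum>j<n. c j)"
        using sum.permute[OF \<tau>, of c] by (simp add: o_def)
      also have "\<dots> = - (\<Sum>j<n. of_nat j)"
        using n by (simp add: c_def sum_subtractf of_bool_def)
      finally show ?thesis by (simp add: x_def sum.distrib)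
    qed
    also have "(\<Sum>k<n - 1. (\<Sum>j<Suc k. x j) * (h k - h (Suc k))) =
        (\<Sum>k<n - 1. of_int (simple_root_coeff n ?\<tau> (Suc k)) * (h k - h (Suc k)))"
    proof (rule sum.cong)
      fix k
      have "(\<Sum>j<Suc k. x j) = of_int (simple_root_coeff n ?\<tau> (Suc k))"
        unfolding simple_root_coeff_def of_int_sum
        by (rule sum.cong) (simp_all add: x_def c_def)
      then show "(\<Sum>j<Suc k. x j) * (h k - h (Suc k)) =
          of_int (simple_root_coeff n ?\<tau> (Suc k)) * (h k - h (Suc k))"
        by simp
    qed simp
    finally show ?thesis
      unfolding simple_comb_apply[OF H] h_def mult_zero_left add_0_right .
  qed
qed

section \<open>Products of commuting neighbouring transpositions\<close>

text \<open>
  For a set \<open>D\<close> without neighbours, the product of the transpositions \<open>(a a+1)\<close> with \<open>a \<in> D\<close>.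
\<close>
definition adjacent_swaps :: "nat set \<Rightarrow> nat \<Rightarrow> nat" where
  "adjacent_swaps D x =
     (if x \<in> D then Suc x else if x \<in> Suc ` D then x - 1 else x)"

definition nonadjacent :: "nat set \<Rightarrow> bool" where
  "nonadjacent D \<longleftrightarrow> (\<forall>a\<in>D. Suc a \<notin> D)"

lemma adjacent_swaps_involution:
  assumes "nonadjacent D"
  shows "adjacent_swaps D \<circ> adjacent_swaps D = id"
proof
  fix x
  have "Suc x \<notin> D" if "x \<in> D"
    using assms that by (simp add: nonadjacent_def)
  then show "(adjacent_swaps D \<circ> adjacent_swaps D) x = id x"
    by (cases "x \<in> D"; cases "x \<in> Suc ` D") (auto simp: adjacent_swaps_def)
qed

lemma foldr_transpositions_eq_adjacent_swaps:
  assumes "distinct is" "nonadjacent (set is)"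
  shows "foldr (\<lambda>i \<tau>. Transposition.transpose i (Suc i) \<circ> \<tau>) is id = adjacent_swaps (set is)"
  using assms
proof (induction "is")
  case Nil
  then show ?case by (simp add: adjacent_swaps_def fun_eq_iff)
next
  case (Cons a as)
  have IH: "foldr (\<lambda>i \<tau>. Transposition.transpose i (Suc i) \<circ> \<tau>) as id = adjacent_swaps (set as)"
    using Cons.prems by (intro Cons.IH) (auto simp: nonadjacent_def)
  have a: "a \<notin> set as" "Suc a \<notin> set as" "\<And>b. b \<in> set as \<Longrightarrow> Suc b \<noteq> a"
    using Cons.prems by (auto simp: nonadjacent_def)
  have "Transposition.transpose a (Suc a) (adjacent_swaps (set as) x) = adjacent_swaps (set (a # as)) x" for x
    using a by (auto simp: adjacent_swaps_def Transposition.transpose_def)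
  then have "Transposition.transpose a (Suc a) \<circ> adjacent_swaps (set as) = adjacent_swaps (set (a # as))"
    by (simp add: fun_eq_iff)
  moreover have "foldr (\<lambda>i \<tau>. Transposition.transpose i (Suc i) \<circ> \<tau>) (a # as) id =
      Transposition.transpose a (Suc a) \<circ> foldr (\<lambda>i \<tau>. Transposition.transpose i (Suc i) \<circ> \<tau>) as id"
    by simp
  ultimately show ?case
    by (simp only: IH)
qed

lemma foldr_transpositions_preserves_initial_segment:
  assumes "a \<notin> set is" "x \<le> a"
  shows "foldr (\<lambda>i \<tau>. Transposition.transpose i (Suc i) \<circ> \<tau>) is id x \<le> a"
  using assms(1)
proof (induction "is")
  case (Cons i "is")
  then show ?case
    by (auto simp: Transposition.transpose_def le_less)
qed (use assms in simp)

text \<open>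
  The letters \<open>D\<close> form a word for the permutation. They all occur in every other word: a word
  without the letter \<open>a\<close> maps \<open>{0, \<dots>, a}\<close> to itself, while \<open>a \<in> D\<close> is moved to \<open>a + 1\<close>.
\<close>
lemma weyl_length_adjacent_swaps:
  assumes "nonadjacent D" "\<And>a. a \<in> D \<Longrightarrow> Suc a < n"
  shows "weyl_length n (adjacent_swaps D) = card D"
  unfolding weyl_length_def
proof (rule Least_equality)
  have fin: "finite D"
    using assms(2) by (intro finite_subset[of D "{..<n}"]) (auto dest: Suc_lessD)
  show "\<exists>is. length is = card D \<and> (\<forall>i\<in>set is. Suc i < n) \<and>
      adjacent_swaps D = foldr (\<lambda>i \<tau>. Transposition.transpose i (Suc i) \<circ> \<tau>) is id"
    using assms fin
    by (intro exI[of _ "sorted_list_of_set D"]) (simp add: foldr_transpositions_eq_adjacent_swaps)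
next
  fix k
  assume "\<exists>is. length is = k \<and> (\<forall>i\<in>set is. Suc i < n) \<and>
      adjacent_swaps D = foldr (\<lambda>i \<tau>. Transposition.transpose i (Suc i) \<circ> \<tau>) is id"
  then obtain "is" where w: "length is = k"
      "adjacent_swaps D = foldr (\<lambda>i \<tau>. Transposition.transpose i (Suc i) \<circ> \<tau>) is id"
    by blast
  have "a \<in> set is" if "a \<in> D" for a
  proof (rule ccontr)
    assume "a \<notin> set is"
    then have "adjacent_swaps D a \<le> a"
      unfolding w(2) by (rule foldr_transpositions_preserves_initial_segment) simp
    with that show False by (simp add: adjacent_swaps_def)
  qed
  then have "card D \<le> card (set is)"
    by (intro card_mono) auto
  also have "\<dots> \<le> k"
    using w(1) card_length by blast
  finally show "card D \<le> k" .
qed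

section \<open>Permutations with non-negative coefficients\<close>

text \<open>
  Scan the initial segments \<open>{0, \<dots>, k - 1}\<close>, \<open>1 \<le> k < n\<close>, from left to right. Only two situations are possible: the segment is preserved and the coefficient is \<open>1\<close>
  (\<open>closed_at\<close>), or \<open>k - 1\<close> has been sent to \<open>k\<close> from a preserved segment and the coefficient has
  dropped to \<open>0\<close> (\<open>open_at\<close>). In the second situation the coefficient cannot drop further, so the
  swap must be completed at once.
\<close>

context
  fixes n :: nat and \<tau> :: "nat \<Rightarrow> nat"
  assumes n: "n \<ge> 2" and \<tau>: "\<tau> permutes {..<n}"
    and nonneg: "\<And>k. Suc k < n \<Longrightarrow> simple_root_coeff n \<tau> (Suc k) \<ge> 0"
begin

private lemma inj: "\<tau> x = \<tau> y \<longleftrightarrow> x = y"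
  using permutes_inj[OF \<tau>] by (auto dest: injD)

private lemma image_initial_segment_ge:
  assumes "\<tau> ` {..<k} = {..<k}" "k \<le> x"
  shows "k \<le> \<tau> x"
proof (rule ccontr)
  assume "\<not> k \<le> \<tau> x"
  then have "\<tau> x \<in> \<tau> ` {..<k}" using assms(1) by simp
  with assms(2) show False using inj by auto
qed

private lemma initial_zero: "\<tau> 0 = 0"
  using nonneg[of 0] n by (auto simp: simple_root_coeff_def of_bool_def split: if_splits)

private definition closed_at where "closed_at k \<longleftrightarrow> \<tau> ` {..<k} = {..<k} \<and> simple_root_coeff n \<tau> k = 1"

text \<open>
  The bound \<open>k < n - 1\<close> holds because sending a letter to \<open>n - 1\<close> costs one more unit of the
  coefficient; it keeps the last letter fixed.
\<close>

private definition open_at where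
  "open_at k \<longleftrightarrow> closed_at (k - 1) \<and> 2 \<le> k \<and> k < n - 1 \<and> \<tau> (k - 1) = k \<and> simple_root_coeff n \<tau> k = 0"

private lemma closed_step:
  assumes "closed_at k" "1 \<le> k" "Suc k < n"
  shows "\<tau> k = k \<and> closed_at (Suc k) \<or> open_at (Suc k)"
proof -
  have im: "\<tau> ` {..<k} = {..<k}"
    using assms by (simp add: closed_at_def)
  have ge: "k \<le> \<tau> k"
    using image_initial_segment_ge[OF im] by simp
  have "0 \<le> 1 + (int k - int (\<tau> k) + of_bool (\<tau> k = 0) - of_bool (\<tau> k = n - 1))"
    using nonneg[OF assms(3)] assms(1) by (simp add: simple_root_coeff_Suc closed_at_def)
  then have "\<tau> k = k \<and> simple_root_coeff n \<tau> (Suc k) = 1 \<or>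
      \<tau> k = Suc k \<and> Suc k \<noteq> n - 1 \<and> simple_root_coeff n \<tau> (Suc k) = 0"
    using ge assms by (auto simp: simple_root_coeff_Suc closed_at_def of_bool_def split: if_splits)
  then show ?thesis
    using im assms by (auto simp: closed_at_def open_at_def lessThan_Suc)
qed

private lemma open_step:
  assumes "open_at k"
  shows "\<tau> k = k - 1 \<and> closed_at (Suc k)"
proof -
  obtain l where k: "k = Suc l" "1 \<le> l"
    using assms by (cases k) (auto simp: open_at_def)
  have im: "\<tau> ` {..<l} = {..<l}" and l: "\<tau> l = k"
    using assms k by (auto simp: open_at_def closed_at_def)
  have ge: "l \<le> \<tau> k"
    using image_initial_segment_ge[OF im] k by simp
  have ne: "\<tau> k \<noteq> k"
    using l inj[of k l] k by auto
  have "Suc k < n" "simple_root_coeff n \<tau> k = 0"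
    using assms by (auto simp: open_at_def)
  then have "0 \<le> int k - int (\<tau> k) + of_bool (\<tau> k = 0) - of_bool (\<tau> k = n - 1)"
    using nonneg[of k] simple_root_coeff_Suc[of n \<tau> k] by simp
  then have "\<tau> k = l" "simple_root_coeff n \<tau> (Suc k) = 1"
    using ge ne k assms by (auto simp: simple_root_coeff_Suc open_at_def of_bool_def split: if_splits)
  moreover have "\<tau> ` {..<Suc k} = {..<Suc k}"
    using im l \<open>\<tau> k = l\<close> k by (auto simp: lessThan_Suc)
  ultimately show ?thesis
    using k by (simp add: closed_at_def)
qed

private lemma closed_or_open:
  assumes "1 \<le> k" "k < n"
  shows "closed_at k \<or> open_at k"
  using assms
proof (induction k rule: dec_induct)
  case base
  then show ?case
    using initial_zero n by (simp add: closed_at_def simple_root_coeff_def)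
next
  case (step k)
  then show ?case using closed_step[of k] open_step[of k] by auto
qed

private lemma open_iff: 
  assumes "1 \<le> k" "k < n"
  shows "open_at k \<longleftrightarrow> \<tau> (k - 1) = k"
proof
  assume *: "\<tau> (k - 1) = k"
  have "\<not> closed_at k"
  proof
    assume "closed_at k"
    then have "\<tau> ` {..<k} = {..<k}" by (simp add: closed_at_def)
    moreover have "\<tau> (k - 1) \<in> \<tau> ` {..<k}"
      using assms by (intro imageI) auto
    ultimately show False using * by simp
  qed
  then show "open_at k" using closed_or_open assms by blast
qed (simp add: open_at_def)

lemma nonadjacent_ascents: "nonadjacent {a. \<tau> a = Suc a}"
  unfolding nonadjacent_def
proof safe
  fix a assume a: "\<tau> a = Suc a" "\<tau> (Suc a) = Suc (Suc a)"
  have "Suc a < n"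
    using a(1) permutes_in_image[OF \<tau>, of a] permutes_not_in[OF \<tau>, of a] by fastforce
  then show False
    using open_step[of "Suc a"] open_iff[of "Suc a"] a by simp
qed

lemma ascents_bounds:
  assumes "\<tau> a = Suc a"
  shows "1 \<le> a" "Suc (Suc a) < n"
proof -
  have "Suc a < n"
    using assms permutes_in_image[OF \<tau>, of a] permutes_not_in[OF \<tau>, of a] by fastforce
  then have "open_at (Suc a)" using open_iff[of "Suc a"] assms by simp
  then show "1 \<le> a" "Suc (Suc a) < n" by (auto simp: open_at_def)
qed

lemma simple_root_coeff_eq:
  assumes "Suc k < n"
  shows "simple_root_coeff n \<tau> (Suc k) = of_bool (\<tau> k \<noteq> Suc k)"
  using closed_or_open[of "Suc k"] open_iff[of "Suc k"] assms
  by (auto simp: closed_at_def open_at_def)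

lemma eq_adjacent_swaps_ascents: "\<tau> = adjacent_swaps {a. \<tau> a = Suc a}"
proof
  fix x
  have x_range: "x < n" if "\<tau> x \<noteq> x"
    using permutes_not_in[OF \<tau>, of x] that by auto
  have "\<tau> x = x - 1" if x: "x \<in> Suc ` {a. \<tau> a = Suc a}"
  proof -
    obtain a where a: "x = Suc a" "\<tau> a = Suc a" using x by blast
    have "open_at x"
      using open_iff[of x] ascents_bounds(2)[OF a(2)] a by simp
    then show ?thesis using open_step by blast
  qed
  moreover have "\<tau> x = x" if x: "\<tau> x \<noteq> Suc x" "x \<notin> Suc ` {a. \<tau> a = Suc a}"
  proof (rule ccontr)
    assume ne: "\<tau> x \<noteq> x"
    then have "x < n" "1 \<le> x"
      using x_range initial_zero by (auto simp: Suc_le_eq intro: Nat.gr0I)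
    moreover have "\<tau> (x - 1) \<noteq> x"
    proof
      assume "\<tau> (x - 1) = x"
      with \<open>1 \<le> x\<close> have "x - 1 \<in> {a. \<tau> a = Suc a}" "x = Suc (x - 1)" by auto
      with x(2) show False by blast
    qed
    ultimately have closed: "closed_at x"
      using closed_or_open open_iff by blast
    show False
    proof (cases "Suc x < n")
      case True
      then show False
        using closed_step[OF closed] open_iff[of "Suc x"] \<open>1 \<le> x\<close> ne x(1) by auto
    next
      case False
      have "x \<le> \<tau> x"
        using closed image_initial_segment_ge by (simp add: closed_at_def)
      moreover have "\<tau> x < n"
        using permutes_in_image[OF \<tau>, of x] \<open>x < n\<close> by simp
      ultimately show False using False ne by simp
    qed
  qed
  ultimately show "\<tau> x = adjacent_swaps {a. \<tau> a = Suc a} x"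
    by (cases "x \<in> {a. \<tau> a = Suc a}") (simp_all add: adjacent_swaps_def)
qed

end

theorem proposition3p1:
  fixes r :: nat and \<sigma> :: "nat \<Rightarrow> nat"
  assumes "r \<ge> 1"
    and "\<sigma> \<in> weyl_alternation_set (r + 1) (highest_root (r + 1)) 0"
  shows "1 + 2 * weyl_length (r + 1) \<sigma> \<le> r \<and>
    kostant_q (r + 1)
      (weyl_act (r + 1) \<sigma> (highest_root (r + 1) + rho (r + 1)) - rho (r + 1)) =
    monom 1 1 ^ (1 + weyl_length (r + 1) \<sigma>) *
      (1 + monom 1 1) ^ (r - 1 - 2 * weyl_length (r + 1) \<sigma>)"
proof -
  define n where "n = r + 1"
  define \<tau> where "\<tau> = inv_into UNIV \<sigma>"
  have n: "n \<ge> 2"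
    using assms(1) by (simp add: n_def)
  let ?\<xi> = "weyl_act n \<sigma> (highest_root n + rho n) - rho n"
  have \<sigma>: "\<sigma> permutes {..<n}" and pos: "kostant n ?\<xi> > 0"
    using assms(2) by (auto simp: weyl_alternation_set_def n_def)
  have \<tau>: "\<tau> permutes {..<n}"
    unfolding \<tau>_def using \<sigma> by (rule permutes_inv)
  have \<xi>: "?\<xi> = simple_comb n (\<lambda>k. of_int (simple_root_coeff n \<tau> (Suc k)))"
    unfolding \<tau>_def by (rule shifted_highest_root_eq_simple_comb[OF \<sigma> n])
  obtain m where m: "m \<in> kostant_partitions n ?\<xi>"
    using pos by (auto simp: kostant_def card_gt_0_iff)
  have nonneg: "simple_root_coeff n \<tau> (Suc k) \<ge> 0" if "Suc k < n" for k
  proof -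
    have "(of_nat (cover n m k) :: complex) = of_int (simple_root_coeff n \<tau> (Suc k))"
      using m that unfolding \<xi> kostant_partitions_simple_comb by blast
    then have "int (cover n m k) = simple_root_coeff n \<tau> (Suc k)"
      by (metis of_int_eq_iff of_int_of_nat_eq)
    then show ?thesis by simp
  qed
  note facts = n \<tau> nonneg
  define D where "D = {a. \<tau> a = Suc a}"
  define K where "K = {..<r} - D"
  have nonadj: "nonadjacent D"
    unfolding D_def by (rule nonadjacent_ascents[OF facts])
  have bounds: "1 \<le> a" "Suc a < r" if "a \<in> D" for a
    using ascents_bounds[OF facts, of a] that by (auto simp: D_def n_def)
  have D: "D \<subseteq> {..<r}"
    using bounds(2) by fastforce
  then have finD: "finite D"
    by (rule finite_subset) simp
  have \<tau>_eq: "\<tau> = adjacent_swaps D"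
    unfolding D_def by (rule eq_adjacent_swaps_ascents[OF facts])
  \<comment> \<open>The description is of \<open>\<tau> = \<sigma>\<^sup>-\<^sup>1\<close>; as an involution it equals \<open>\<sigma>\<close>.\<close>
  have "\<sigma> = \<sigma> \<circ> (\<tau> \<circ> \<tau>)"
    unfolding \<tau>_eq adjacent_swaps_involution[OF nonadj] by simp
  also have "\<dots> = \<tau>"
    unfolding \<tau>_def using permutes_inv_o(1)[OF \<sigma>] by (simp flip: o_assoc add: o_assoc)
  finally have "\<sigma> = adjacent_swaps D"
    using \<tau>_eq by simp
  then have len: "weyl_length (r + 1) \<sigma> = card D"
    using weyl_length_adjacent_swaps[OF nonadj, of "r + 1"] bounds(2) by force
  have \<xi>_K: "?\<xi> = simple_comb n (\<lambda>k. of_bool (k \<in> K))"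
    unfolding \<xi> simple_comb_eq_iff
    using simple_root_coeff_eq[OF facts] by (auto simp: K_def D_def n_def)
  have left: "left_ends K = insert 0 (Suc ` D)"
  proof (rule Set.set_eqI)
    fix k
    show "k \<in> left_ends K \<longleftrightarrow> k \<in> insert 0 (Suc ` D)"
    proof (cases k)
      case 0
      moreover have "0 \<notin> D"
        using bounds(1)[of 0] by auto
      ultimately show ?thesis
        using assms(1) by (simp add: left_ends_def K_def)
    next
      case (Suc l)
      have "Suc l < r \<and> Suc l \<notin> D" if "l \<in> D"
        using that bounds(2) nonadj by (simp add: nonadjacent_def)
      then show ?thesis
        unfolding Suc by (auto simp: left_ends_def K_def)
    qed
  qed
  then have card_left: "card (left_ends K) = 1 + card D"
    using finD by (simp add: card_image)
  have card_K: "card K = r - card D"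
    unfolding K_def using D finD by (simp add: card_Diff_subset)
  have sub: "left_ends K \<subseteq> K" "finite K"
    by (auto simp: left_ends_def K_def)
  have bound: "1 + 2 * card D \<le> r"
    using card_mono[OF sub(2,1)] card_left card_K card_mono[OF _ D] by simp
  have "card (K - left_ends K) = r - 1 - 2 * card D"
    using card_Diff_subset[OF finite_subset[OF sub] sub(1)] card_left card_K by simp
  moreover have "K \<subseteq> {..<n - 1}"
    by (auto simp: K_def n_def)
  ultimately have "kostant_q n ?\<xi> = monom 1 1 ^ (1 + card D) * (1 + monom 1 1) ^ (r - 1 - 2 * card D)"
    unfolding \<xi>_K by (simp only: kostant_q_sum_simple_roots card_left)
  with bound show ?thesis
    unfolding len n_def by simp
qed

end
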